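(* Let $n\geq 3$. Then $\lvert \mathsf{Z}_{1}\rvert=\lvert \mathsf{Z}_{n}\rvert=\binom{2n-4}{n-2}$, and for each $2\leq k\leq n-1$, $$\lvert \mathsf{Z}_{k}\rvert=\lvert \mathsf{R}_{k}\rvert -\left( \binom{2n-4}{n-1} -\binom{2k-4}{k-2} \binom{2n-2k-2}{n-k-1} \right).$$
   Context: For a positive integer $n$, let $X_n=\{1<2<\cdots<n\}$ and let $\mathcal{O}_n$ be the semigroup of all order-preserving maps $\alpha: X_n\to X_n$ (i.e. $x<y$ implies $x\alpha\leq y\alpha$) under composition. Maps are written on the right and composed left to right: $x(\alpha\beta)=(x\alpha)\beta$. For $1\leq k\leq n$, $\pi_k\in\mathcal{O}_n$ is the constant map $x\pi_k=k$ for all $x\in X_n$. For $1\leq k\leq n$, define $$\mathsf{L}_{k} = \{ \alpha \in \mathcal{O}_{n} : \alpha \beta= \pi_{k} \text{ for some } \beta\in \mathcal{O}_{n}\setminus\{\pi_k\} \},$$ $$\mathsf{R}_{k} = \{ \alpha \in \mathcal{O}_{n} : \gamma \alpha =\pi_{k} \text{ for some } \gamma \in \mathcal{O}_{n}\setminus\{\pi_k\} \},$$ and $\mathsf{Z}_k=\mathsf{L}_k\cap\mathsf{R}_k$. *)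

theory Defs
  imports Main "HOL-Library.FuncSet"
begin

text \<open>
  Maps on the chain \<open>{1..n}\<close> are represented by their extensional functions, so that
  equality of maps is equality in HOL and the sets below are finite with the correct cardinality.
  Products are read from left to right: \<open>op_mult n a b\<close> first applies \<open>a\<close>, then \<open>b\<close>.
\<close>

definition order_preserving_maps :: "nat \<Rightarrow> (nat \<Rightarrow> nat) set" where
  "order_preserving_maps n = {a \<in> {1..n} \<rightarrow>\<^sub>E {1..n}. mono_on {1..n} a}"

definition op_mult :: "nat \<Rightarrow> (nat \<Rightarrow> nat) \<Rightarrow> (nat \<Rightarrow> nat) \<Rightarrow> (nat \<Rightarrow> nat)" where
  "op_mult n a b = compose {1..n} b a"

definition const_map :: "nat \<Rightarrow> nat \<Rightarrow> (nat \<Rightarrow> nat)" where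
  "const_map n k = (\<lambda>x\<in>{1..n}. k)"

definition L_set :: "nat \<Rightarrow> nat \<Rightarrow> (nat \<Rightarrow> nat) set" where
  "L_set n k = {a \<in> order_preserving_maps n.
     \<exists>b \<in> order_preserving_maps n - {const_map n k}. op_mult n a b = const_map n k}"

definition R_set :: "nat \<Rightarrow> nat \<Rightarrow> (nat \<Rightarrow> nat) set" where
  "R_set n k = {a \<in> order_preserving_maps n.
     \<exists>c \<in> order_preserving_maps n - {const_map n k}. op_mult n c a = const_map n k}"

definition Z_set :: "nat \<Rightarrow> nat \<Rightarrow> (nat \<Rightarrow> nat) set" where
  "Z_set n k = L_set n k \<inter> R_set n k"

end

theory Submission
  imports Defs
begin

text \<open>
  Membership in \<open>L_set\<close> and \<open>R_set\<close> is a condition on images and fibres. If \<open>\<alpha>\<beta> = \<pi>\<^sub>k\<close>, then the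
  fibre of \<open>\<beta>\<close> over \<open>k\<close> is convex and contains the image of \<open>\<alpha>\<close>; when \<open>\<beta> \<noteq> \<pi>\<^sub>k\<close> this convex set
  is not the whole chain, so it omits an end of the chain, and hence so does the image of \<open>\<alpha>\<close>.
  It must omit \<open>n\<close> if \<open>k = 1\<close> and \<open>1\<close> if \<open>k = n\<close>; for \<open>k\<close> strictly between, either end may be the
  omitted one. Conversely, if such an end is omitted by the image of \<open>\<alpha>\<close>, the map that fixes this
  end and sends every other point to \<open>k\<close> serves as \<open>\<beta>\<close>. If \<open>\<gamma>\<alpha> = \<pi>\<^sub>k\<close> with \<open>\<gamma> \<noteq> \<pi>\<^sub>k\<close>, then the fibre of \<open>\<alpha>\<close> over \<open>k\<close> has a point other than
  \<open>k\<close>, and conversely the constant map at such a point serves as \<open>\<gamma>\<close>.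

  So \<open>Z_set n 1\<close> consists of the maps with \<open>1, 2 \<mapsto> 1\<close> whose last value is below \<open>n\<close>, and dually for
  \<open>Z_set n n\<close>. For \<open>1 < k < n\<close>, the difference of \<open>R_set n k\<close> and \<open>Z_set n k\<close> consists of the maps
  that fix \<open>1\<close> and \<open>n\<close> and whose fibre over \<open>k\<close> is neither empty nor \<open>{k}\<close>. Among the
  \<open>(2n-3) choose (n-2)\<close> maps that fix both ends, \<open>(2n-4) choose (n-2)\<close> have empty fibre over \<open>k\<close>;
  by Pascal's rule the other ones number \<open>(2n-4) choose (n-3) = (2n-4) choose (n-1)\<close>. A map with
  fibre exactly \<open>{k}\<close> splits into independent monotone maps below and above \<open>k\<close>, which accounts for
  the product of binomial coefficients.

  All these counts come from two facts about monotone maps whose values are restricted pointwise: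
  the number is multiplicative when the domain is cut at a place where the restrictions already
  enforce monotonicity (\<open>card_monotone_choices_Un\<close>), and it is a multiset coefficient when the
  restriction is the same at every point (\<open>card_monotone_choices_const\<close>).
\<close>

section \<open>Counting monotone maps with pointwise restricted values\<close>

text \<open>
  The set of admissible values depends on the point, so that conditions such as a prescribed value
  or a prescribed fibre become instances of one family, to which a single product formula applies.
\<close>

definition monotone_choices ::
  "'a::linorder set \<Rightarrow> ('a \<Rightarrow> 'b::linorder set) \<Rightarrow> ('a \<Rightarrow> 'b) set" where
  "monotone_choices A F = {f \<in> PiE A F. mono_on A f}"

lemma finite_monotone_choices:
  assumes "finite A" "\<And>x. x \<in> A \<Longrightarrow> finite (F x)"
  shows "finite (monotone_choices A F)"
  using finite_PiE[OF assms] by (auto simp: monotone_choices_def)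

lemma monotone_choices_value:
  "f \<in> monotone_choices A F \<Longrightarrow> x \<in> A \<Longrightarrow> f x \<in> F x"
  by (auto simp: monotone_choices_def)

lemma monotone_choices_mono:
  "f \<in> monotone_choices A F \<Longrightarrow> (\<And>x. x \<in> A \<Longrightarrow> F x \<subseteq> G x) \<Longrightarrow> f \<in> monotone_choices A G"
  by (auto simp: monotone_choices_def PiE_iff)

lemma monotone_choices_cong:
  assumes "\<And>x. x \<in> A \<Longrightarrow> F x = G x"
  shows "monotone_choices A F = monotone_choices A G"
  unfolding monotone_choices_def using PiE_cong[of A F G] assms by simp

text \<open>
  The hypothesis on values makes monotonicity across the cut automatic, so the restrictions of a
  map to the two parts can be prescribed independently.
\<close>

lemma card_monotone_choices_Un:
  fixes F :: "'a::linorder \<Rightarrow> 'b::linorder set"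
  assumes dom: "\<And>x y. x \<in> A \<Longrightarrow> y \<in> B \<Longrightarrow> x < y"
    and val: "\<And>x y u v. x \<in> A \<Longrightarrow> y \<in> B \<Longrightarrow> u \<in> F x \<Longrightarrow> v \<in> F y \<Longrightarrow> u \<le> v"
  shows "card (monotone_choices (A \<union> B) F)
    = card (monotone_choices A F) * card (monotone_choices B F)"
proof -
  let ?split = "\<lambda>f. (restrict f A, restrict f B)"
  let ?glue = "\<lambda>(g, h). \<lambda>x \<in> A \<union> B. if x \<in> A then g x else h x"
  have disj: "x \<notin> A" if "x \<in> B" for x
    using dom that by blast
  have "bij_betw ?split (monotone_choices (A \<union> B) F)
      (monotone_choices A F \<times> monotone_choices B F)"
  proof (rule bij_betw_byWitness[where f' = ?glue])
    show "\<forall>f \<in> monotone_choices (A \<union> B) F. ?glue (?split f) = f"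
      by (auto simp: monotone_choices_def PiE_def extensional_def fun_eq_iff)
    show "\<forall>p \<in> monotone_choices A F \<times> monotone_choices B F. ?split (?glue p) = p"
      using disj by (auto simp: monotone_choices_def PiE_def extensional_def fun_eq_iff)
    show "?split ` monotone_choices (A \<union> B) F
        \<subseteq> monotone_choices A F \<times> monotone_choices B F"
      by (auto simp: monotone_choices_def mono_on_def)
    have "?glue (g, h) \<in> monotone_choices (A \<union> B) F"
      if g: "g \<in> monotone_choices A F" and h: "h \<in> monotone_choices B F" for g h
    proof -
      have gF: "g x \<in> F x" if "x \<in> A" for x
        using g that by (auto simp: monotone_choices_def)
      have hF: "h x \<in> F x" if "x \<in> B" for x
        using h that by (auto simp: monotone_choices_def)
      have "mono_on (A \<union> B) (?glue (g, h))"
      proof (rule mono_onI)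
        fix r s assume rs: "r \<in> A \<union> B" "s \<in> A \<union> B" "r \<le> s"
        consider "r \<in> A" "s \<in> A" | "r \<in> A" "s \<in> B" | "r \<in> B" "s \<in> B"
          using rs dom by fastforce
        then show "?glue (g, h) r \<le> ?glue (g, h) s"
        proof cases
          case 1
          then show ?thesis
            using g rs by (auto simp: monotone_choices_def mono_on_def)
        next
          case 2
          then show ?thesis
            using val gF hF disj by auto
        next
          case 3
          then show ?thesis
            using h rs disj by (auto simp: monotone_choices_def mono_on_def)
        qed
      qed
      then show ?thesis
        using gF hF by (auto simp: monotone_choices_def)
    qed
    then show "?glue ` (monotone_choices A F \<times> monotone_choices B F)
        \<subseteq> monotone_choices (A \<union> B) F"
      by blast
  qed
  then show ?thesis
    by (simp add: bij_betw_same_card card_cartesian_product)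
qed

lemma card_monotone_choices_singleton:
  assumes "F a = {v}"
  shows "card (monotone_choices {a} F) = 1"
proof -
  have "PiE {a} F = {\<lambda>x \<in> {a}. v}"
    using assms by (simp add: PiE_eq_singleton)
  then have "monotone_choices {a} F = {\<lambda>x \<in> {a}. v}"
    by (auto simp: monotone_choices_def mono_on_def)
  then show ?thesis by simp
qed

lemma card_monotone_choices_pin_first:
  assumes "\<And>x. x \<in> A \<Longrightarrow> a < x" "F a = {v}" "\<And>x u. x \<in> A \<Longrightarrow> u \<in> F x \<Longrightarrow> v \<le> u"
  shows "card (monotone_choices (insert a A) F) = card (monotone_choices A F)"
  using card_monotone_choices_Un[of "{a}" A F] card_monotone_choices_singleton[of F a v] assms
  by simp

lemma card_monotone_choices_pin_last:
  assumes "\<And>x. x \<in> A \<Longrightarrow> x < a" "F a = {v}" "\<And>x u. x \<in> A \<Longrightarrow> u \<in> F x \<Longrightarrow> u \<le> v"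
  shows "card (monotone_choices (insert a A) F) = card (monotone_choices A F)"
  using card_monotone_choices_Un[of A "{a}" F] card_monotone_choices_singleton[of F a v] assms
  by simp

text \<open>
  Pascal's rule: a monotone map either sends the last point to the largest value, and is then
  arbitrary on the remaining points, or never takes the largest value.
\<close>

lemma card_monotone_choices_const:
  fixes A :: "'a::linorder set" and V :: "'b::linorder set"
  assumes "finite A" "finite V"
  shows "card (monotone_choices A (\<lambda>_. V)) = (card A + card V - 1) choose card A"
  using assms
proof (induction "card A + card V" arbitrary: A V rule: less_induct)
  case less
  consider "A = {}" | "A \<noteq> {}" "V = {}" | "A \<noteq> {}" "V \<noteq> {}"
    by blast
  then show ?case
  proof cases
    case 1
    then have "monotone_choices A (\<lambda>_. V) = {\<lambda>_. undefined}"
      by (auto simp: monotone_choices_def mono_on_def)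
    with 1 show ?thesis by simp
  next
    case 2
    then have "monotone_choices A (\<lambda>_. V) = {}"
      by (auto simp: monotone_choices_def)
    moreover have "card A > 0"
      using 2 less.prems by (simp add: card_gt_0_iff)
    ultimately show ?thesis using 2 by simp
  next
    case 3
    define a where "a = Max A"
    define v where "v = Max V"
    have a: "a \<in> A" "\<And>x. x \<in> A \<Longrightarrow> x \<le> a"
      using 3 less.prems by (auto simp: a_def)
    have v: "v \<in> V" "\<And>u. u \<in> V \<Longrightarrow> u \<le> v"
      using 3 less.prems by (auto simp: v_def)
    obtain p where p: "card A = Suc p"
      using a less.prems by (metis card_Suc_Diff1)
    obtain q where q: "card V = Suc q"
      using v less.prems by (metis card_Suc_Diff1)
    let ?F = "\<lambda>x. if x = a then {v} else V"
    have split: "monotone_choices A (\<lambda>_. V)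
        = monotone_choices A ?F \<union> monotone_choices A (\<lambda>_. V - {v})"
    proof (intro equalityI subsetI)
      fix f assume f: "f \<in> monotone_choices A (\<lambda>_. V)"
      show "f \<in> monotone_choices A ?F \<union> monotone_choices A (\<lambda>_. V - {v})"
      proof (cases "f a = v")
        case True
        then show ?thesis
          using f by (auto simp: monotone_choices_def PiE_iff split: if_splits)
      next
        case False
        have "f x \<noteq> v" if "x \<in> A" for x
        proof -
          have "f x \<le> f a" "f a \<in> V"
            using f that a by (auto simp: monotone_choices_def mono_on_def)
          with False v show ?thesis by fastforce
        qed
        then show ?thesis using f by (auto simp: monotone_choices_def PiE_def)
      qed
    next
      fix f assume "f \<in> monotone_choices A ?F \<union> monotone_choices A (\<lambda>_. V - {v})"
      then show "f \<in> monotone_choices A (\<lambda>_. V)"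
        using v by (auto simp: monotone_choices_def PiE_def Pi_def split: if_splits)
    qed
    have disj: "monotone_choices A ?F \<inter> monotone_choices A (\<lambda>_. V - {v}) = {}"
      using a by (fastforce simp: monotone_choices_def PiE_def Pi_def)
    have "card (monotone_choices (insert a (A - {a})) ?F)
        = card (monotone_choices (A - {a}) ?F)"
      by (rule card_monotone_choices_pin_last[where v = v])
        (use a v in \<open>auto simp: order.strict_iff_order\<close>)
    also have "monotone_choices (A - {a}) ?F = monotone_choices (A - {a}) (\<lambda>_. V)"
      by (rule monotone_choices_cong) auto
    also have "card \<dots> = (p + Suc q - 1) choose p"
      using less.hyps[of "A - {a}" V] less.prems a p q by simp
    also have "insert a (A - {a}) = A"
      using a by blast
    finally have top: "card (monotone_choices A ?F) = (p + q) choose p"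
      by simp
    have rest: "card (monotone_choices A (\<lambda>_. V - {v})) = (p + q) choose Suc p"
      using less.hyps[of A "V - {v}"] less.prems v p q by simp
    have "card (monotone_choices A (\<lambda>_. V)) = ((p + q) choose p) + ((p + q) choose Suc p)"
      unfolding split using disj top rest less.prems
      by (subst card_Un_disjoint) (auto intro!: finite_monotone_choices)
    then show ?thesis
      using p q by simp
  qed
qed

section \<open>Fibre descriptions of the sets of divisors\<close>

lemma order_preserving_maps_eq:
  "order_preserving_maps n = monotone_choices {1..n} (\<lambda>_. {1..n})"
  by (simp add: order_preserving_maps_def monotone_choices_def)

lemma const_map_in_order_preserving_maps:
  "k \<in> {1..n} \<Longrightarrow> const_map n k \<in> order_preserving_maps n"
  by (auto simp: const_map_def order_preserving_maps_def mono_on_def)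

lemma order_preserving_maps_D:
  assumes "a \<in> order_preserving_maps n"
  shows "x \<in> {1..n} \<Longrightarrow> a x \<in> {1..n}"
    and "x \<in> {1..n} \<Longrightarrow> y \<in> {1..n} \<Longrightarrow> x \<le> y \<Longrightarrow> a x \<le> a y"
  using assms by (auto simp: order_preserving_maps_def mono_on_def)

lemma op_mult_eq_const_map_iff:
  "op_mult n a b = const_map n k \<longleftrightarrow> (\<forall>x \<in> {1..n}. b (a x) = k)"
  by (auto simp: op_mult_def const_map_def compose_def restrict_def fun_eq_iff)

lemma neq_const_mapD:
  assumes "b \<in> order_preserving_maps n" "b \<noteq> const_map n k"
  obtains x where "x \<in> {1..n}" "b x \<noteq> k"
proof -
  have "\<exists>x \<in> {1..n}. b x \<noteq> k"
  proof (rule ccontr)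
    assume "\<not> ?thesis"
    then have "b x = const_map n k x" for x
      using assms(1)
      by (cases "x \<in> {1..n}")
        (auto simp: const_map_def order_preserving_maps_def PiE_def extensional_def)
    with assms(2) show False by blast
  qed
  then show ?thesis using that by blast
qed

lemma R_set_iff:
  assumes "k \<in> {1..n}"
  shows "a \<in> R_set n k \<longleftrightarrow> a \<in> order_preserving_maps n \<and> (\<exists>x \<in> {1..n}. x \<noteq> k \<and> a x = k)"
proof
  assume "a \<in> R_set n k"
  then obtain c where "a \<in> order_preserving_maps n" and c: "c \<in> order_preserving_maps n"
    "c \<noteq> const_map n k" "\<forall>x \<in> {1..n}. a (c x) = k"
    by (auto simp: R_set_def op_mult_eq_const_map_iff)
  moreover obtain x where "x \<in> {1..n}" "c x \<noteq> k"
    using c neq_const_mapD by metis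
  ultimately show "a \<in> order_preserving_maps n \<and> (\<exists>x \<in> {1..n}. x \<noteq> k \<and> a x = k)"
    using order_preserving_maps_D(1) by blast
next
  assume *: "a \<in> order_preserving_maps n \<and> (\<exists>x \<in> {1..n}. x \<noteq> k \<and> a x = k)"
  then obtain x where x: "x \<in> {1..n}" "x \<noteq> k" "a x = k" by blast
  have "const_map n x k \<noteq> const_map n k k"
    using x assms by (simp add: const_map_def)
  then have "const_map n x \<noteq> const_map n k" by metis
  moreover have "op_mult n (const_map n x) a = const_map n k"
    unfolding op_mult_eq_const_map_iff using x by (simp add: const_map_def)
  ultimately show "a \<in> R_set n k"
    using * x const_map_in_order_preserving_maps unfolding R_set_def by blast
qed

text \<open>
  An end of the chain can be the point moved away from \<open>k\<close> by a right factor only if there is room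
  beyond \<open>k\<close> on that side, whence the side conditions \<open>1 < k\<close> and \<open>k < n\<close>.
\<close>

lemma L_set_iff:
  assumes k: "k \<in> {1..n}"
  shows "a \<in> L_set n k \<longleftrightarrow>
    a \<in> order_preserving_maps n \<and> (1 < k \<and> a 1 \<noteq> 1 \<or> k < n \<and> a n \<noteq> n)"
proof
  assume "a \<in> L_set n k"
  then obtain b where a: "a \<in> order_preserving_maps n" and b: "b \<in> order_preserving_maps n"
    "b \<noteq> const_map n k" "\<forall>x \<in> {1..n}. b (a x) = k"
    by (auto simp: L_set_def op_mult_eq_const_map_iff)
  obtain y where y: "y \<in> {1..n}" "b y \<noteq> k"
    using b neq_const_mapD by metis
  have ends: "1 \<in> {1..n}" "n \<in> {1..n}"
    using k by auto
  have range: "b 1 \<in> {1..n}" "b n \<in> {1..n}"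
    using order_preserving_maps_D(1) b(1) ends by blast+
  have "b 1 \<le> b y" "b y \<le> b n"
    using order_preserving_maps_D(2)[OF b(1)] ends y by auto
  then consider "b 1 < k" | "k < b n"
    using y by linarith
  then have "1 < k \<and> a 1 \<noteq> 1 \<or> k < n \<and> a n \<noteq> n"
  proof cases
    case 1
    moreover have "a 1 \<noteq> 1"
      using 1 b(3) ends(1) by (metis less_irrefl)
    ultimately show ?thesis
      using range(1) by simp
  next
    case 2
    moreover have "a n \<noteq> n"
      using 2 b(3) ends(2) by (metis less_irrefl)
    ultimately show ?thesis
      using range(2) by simp
  qed
  with a show "a \<in> order_preserving_maps n \<and> (1 < k \<and> a 1 \<noteq> 1 \<or> k < n \<and> a n \<noteq> n)"
    by blast
next
  assume *: "a \<in> order_preserving_maps n \<and> (1 < k \<and> a 1 \<noteq> 1 \<or> k < n \<and> a n \<noteq> n)"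
  then have a: "a \<in> order_preserving_maps n" by blast
  have range: "a x \<in> {1..n}" "a 1 \<le> a x" "a x \<le> a n" if "x \<in> {1..n}" for x
    using order_preserving_maps_D[OF a] that by auto
  from * consider "1 < k" "a 1 \<noteq> 1" | "k < n" "a n \<noteq> n" by blast
  then show "a \<in> L_set n k"
  proof cases
    case 1
    let ?b = "\<lambda>x \<in> {1..n}. if x = 1 then 1 else k"
    have "?b \<in> order_preserving_maps n"
      using k by (auto simp: order_preserving_maps_def mono_on_def)
    moreover have "?b 1 \<noteq> const_map n k 1"
      using k 1 by (simp add: const_map_def)
    then have "?b \<noteq> const_map n k" by metis
    moreover have "?b (a x) = k" if "x \<in> {1..n}" for x
      using range[OF that] range(1)[of 1] 1 k by auto
    then have "op_mult n a ?b = const_map n k"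
      unfolding op_mult_eq_const_map_iff by blast
    ultimately show ?thesis
      using a unfolding L_set_def by blast
  next
    case 2
    let ?b = "\<lambda>x \<in> {1..n}. if x = n then n else k"
    have "?b \<in> order_preserving_maps n"
      using k by (auto simp: order_preserving_maps_def mono_on_def)
    moreover have "?b n \<noteq> const_map n k n"
      using k 2 by (simp add: const_map_def)
    then have "?b \<noteq> const_map n k" by metis
    moreover have "?b (a x) = k" if "x \<in> {1..n}" for x
      using range[OF that] range(1)[of n] 2 k by auto
    then have "op_mult n a ?b = const_map n k"
      unfolding op_mult_eq_const_map_iff by blast
    ultimately show ?thesis
      using a unfolding L_set_def by blast
  qed
qed

section \<open>The two ends of the chain\<close>

lemma card_Z_set_first:
  assumes n: "n \<ge> 3"
  shows "card (Z_set n 1) = (2 * n - 4) choose (n - 2)"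
proof -
  let ?F = "\<lambda>x. if x \<le> 2 then {1} else {1..n - 1}"
  have "Z_set n 1 = monotone_choices {1..n} ?F"
  proof (intro equalityI subsetI)
    fix a assume "a \<in> Z_set n 1"
    then obtain x where a: "a \<in> order_preserving_maps n" and last: "a n \<noteq> n"
      and x: "x \<in> {1..n}" "x \<noteq> 1" "a x = 1"
      using n by (auto simp: Z_set_def R_set_iff L_set_iff)
    have "a y \<in> ?F y" if y: "y \<in> {1..n}" for y
    proof -
      have "y \<le> x \<Longrightarrow> a y \<le> a x" "a y \<le> a n" "a y \<in> {1..n}" "a n \<in> {1..n}"
        using order_preserving_maps_D[OF a] x(1) y n by auto
      then show ?thesis
        using x y last by auto
    qed
    then show "a \<in> monotone_choices {1..n} ?F"
      using a by (auto simp: order_preserving_maps_def monotone_choices_def PiE_def)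
  next
    fix a assume a: "a \<in> monotone_choices {1..n} ?F"
    have v: "a x \<in> ?F x" if "x \<in> {1..n}" for x
      using monotone_choices_value[OF a that] .
    have "a \<in> order_preserving_maps n"
      unfolding order_preserving_maps_eq
      by (rule monotone_choices_mono[OF a]) (use n in auto)
    moreover have "a 2 = 1" "a n \<noteq> n"
      using v[of 2] v[of n] n by auto
    ultimately show "a \<in> Z_set n 1"
      using n by (auto simp: Z_set_def R_set_iff L_set_iff intro!: bexI[of _ 2])
  qed
  moreover have "{1..n} = insert 1 (insert 2 {3..n})"
    using n by auto
  ultimately have "card (Z_set n 1) = card (monotone_choices (insert 1 (insert 2 {3..n})) ?F)"
    by simp
  also have "\<dots> = card (monotone_choices (insert 2 {3..n}) ?F)"
    by (rule card_monotone_choices_pin_first) (auto split: if_splits)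
  also have "\<dots> = card (monotone_choices {3..n} ?F)"
    by (rule card_monotone_choices_pin_first) (auto split: if_splits)
  also have "monotone_choices {3..n} ?F = monotone_choices {3..n} (\<lambda>_. {1..n - 1})"
    by (rule monotone_choices_cong) auto
  also have "card \<dots> = (2 * n - 4) choose (n - 2)"
    using n by (simp add: card_monotone_choices_const mult_2 numeral_eq_Suc)
  finally show ?thesis .
qed

lemma card_Z_set_last:
  assumes n: "n \<ge> 3"
  shows "card (Z_set n n) = (2 * n - 4) choose (n - 2)"
proof -
  let ?F = "\<lambda>x. if n - 1 \<le> x then {n} else {2..n}"
  have "Z_set n n = monotone_choices {1..n} ?F"
  proof (intro equalityI subsetI)
    fix a assume "a \<in> Z_set n n"
    then obtain x where a: "a \<in> order_preserving_maps n" and first: "a 1 \<noteq> 1"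
      and x: "x \<in> {1..n}" "x \<noteq> n" "a x = n"
      using n by (auto simp: Z_set_def R_set_iff L_set_iff)
    have "a y \<in> ?F y" if y: "y \<in> {1..n}" for y
    proof -
      have "x \<le> y \<Longrightarrow> a x \<le> a y" "a 1 \<le> a y" "a y \<in> {1..n}" "a 1 \<in> {1..n}"
        using order_preserving_maps_D[OF a] x(1) y n by auto
      then show ?thesis
        using x y first by auto
    qed
    then show "a \<in> monotone_choices {1..n} ?F"
      using a by (auto simp: order_preserving_maps_def monotone_choices_def PiE_def)
  next
    fix a assume a: "a \<in> monotone_choices {1..n} ?F"
    have v: "a x \<in> ?F x" if "x \<in> {1..n}" for x
      using monotone_choices_value[OF a that] .
    have "a \<in> order_preserving_maps n"
      unfolding order_preserving_maps_eq
      by (rule monotone_choices_mono[OF a]) (use n in auto)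
    moreover have "a (n - 1) = n" "a 1 \<noteq> 1"
      using v[of "n - 1"] v[of 1] n by (auto split: if_splits)
    ultimately show "a \<in> Z_set n n"
      using n by (auto simp: Z_set_def R_set_iff L_set_iff intro!: bexI[of _ "n - 1"])
  qed
  moreover have "{1..n} = insert n (insert (n - 1) {1..n - 2})"
    using n by auto
  ultimately have "card (Z_set n n)
      = card (monotone_choices (insert n (insert (n - 1) {1..n - 2})) ?F)"
    by simp
  also have "\<dots> = card (monotone_choices (insert (n - 1) {1..n - 2}) ?F)"
    by (rule card_monotone_choices_pin_last) (use n in \<open>auto split: if_splits\<close>)
  also have "\<dots> = card (monotone_choices {1..n - 2} ?F)"
    by (rule card_monotone_choices_pin_last) (use n in \<open>auto split: if_splits\<close>)
  also have "monotone_choices {1..n - 2} ?F = monotone_choices {1..n - 2} (\<lambda>_. {2..n})"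
    by (rule monotone_choices_cong) (use n in auto)
  also have "card \<dots> = (2 * n - 4) choose (n - 2)"
    using n by (simp add: card_monotone_choices_const mult_2 numeral_eq_Suc)
  finally show ?thesis .
qed

section \<open>The interior of the chain\<close>

definition end_fixing_maps :: "nat \<Rightarrow> (nat \<Rightarrow> nat) set" where
  "end_fixing_maps n = {a \<in> order_preserving_maps n. a 1 = 1 \<and> a n = n}"

text \<open>
  Used with \<open>W\<close> the whole chain, to count all maps that fix both ends, and with \<open>W\<close> the chain
  without \<open>k\<close>, to count those whose fibre over \<open>k\<close> is empty.
\<close>

lemma card_end_fixing_maps_into:
  assumes n: "n \<ge> 2" and W: "W \<subseteq> {1..n}" "1 \<in> W" "n \<in> W"
  shows "card {a \<in> end_fixing_maps n. a ` {1..n} \<subseteq> W} = (n - 2 + card W - 1) choose (n - 2)"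
proof -
  let ?F = "\<lambda>x. if x = 1 then {1} else if x = n then {n} else W"
  have "{a \<in> end_fixing_maps n. a ` {1..n} \<subseteq> W} = monotone_choices {1..n} ?F"
  proof (intro equalityI subsetI)
    fix a assume "a \<in> {a \<in> end_fixing_maps n. a ` {1..n} \<subseteq> W}"
    then show "a \<in> monotone_choices {1..n} ?F"
      by (auto simp: end_fixing_maps_def order_preserving_maps_def monotone_choices_def PiE_iff)
  next
    fix a assume a: "a \<in> monotone_choices {1..n} ?F"
    have v: "a x \<in> ?F x" if "x \<in> {1..n}" for x
      using monotone_choices_value[OF a that] .
    then have "a x \<in> W" if "x \<in> {1..n}" for x
      using that W by (force split: if_splits)
    moreover have "a 1 = 1" "a n = n"
      using v[of 1] v[of n] n by auto
    ultimately show "a \<in> {a \<in> end_fixing_maps n. a ` {1..n} \<subseteq> W}"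
      using a W
      by (fastforce simp: end_fixing_maps_def order_preserving_maps_def monotone_choices_def PiE_iff)
  qed
  moreover have "{1..n} = insert 1 (insert n {2..n - 1})"
    using n by auto
  ultimately have "card {a \<in> end_fixing_maps n. a ` {1..n} \<subseteq> W}
      = card (monotone_choices (insert 1 (insert n {2..n - 1})) ?F)"
    by simp
  also have "\<dots> = card (monotone_choices (insert n {2..n - 1}) ?F)"
    by (rule card_monotone_choices_pin_first[where v = 1]) (use n W in \<open>auto split: if_splits\<close>)
  also have "\<dots> = card (monotone_choices {2..n - 1} ?F)"
    by (rule card_monotone_choices_pin_last[where v = n]) (use n W in \<open>auto split: if_splits\<close>)
  also have "monotone_choices {2..n - 1} ?F = monotone_choices {2..n - 1} (\<lambda>_. W)"
    by (rule monotone_choices_cong) (use n in auto)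
  also have "card \<dots> = (n - 2 + card W - 1) choose (n - 2)"
    using n W finite_subset[OF W(1)] by (simp add: card_monotone_choices_const numeral_eq_Suc)
  finally show ?thesis .
qed

text \<open>
  A monotone map has fibre \<open>{k}\<close> over \<open>k\<close> exactly when it fixes \<open>k\<close>, sends the points below \<open>k\<close> to
  values below \<open>k\<close>, and sends the points above \<open>k\<close> to values above \<open>k\<close>. The two halves are then
  counted separately; each has one end fixed.
\<close>

lemma card_end_fixing_maps_singleton_fibre:
  assumes k: "2 \<le> k" "k \<le> n - 1"
  shows "card {a \<in> end_fixing_maps n. \<forall>x \<in> {1..n}. a x = k \<longleftrightarrow> x = k}
    = ((2 * k - 4) choose (k - 2)) * ((2 * n - 2 * k - 2) choose (n - k - 1))"
proof -
  let ?F = "\<lambda>x. if x = 1 then {1} else if x < k then {1..k - 1} else if x = k then {k}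
    else if x = n then {n} else {k + 1..n}"
  have "{a \<in> end_fixing_maps n. \<forall>x \<in> {1..n}. a x = k \<longleftrightarrow> x = k} = monotone_choices {1..n} ?F"
  proof (intro equalityI subsetI)
    fix a assume "a \<in> {a \<in> end_fixing_maps n. \<forall>x \<in> {1..n}. a x = k \<longleftrightarrow> x = k}"
    then have a: "a \<in> order_preserving_maps n" "a 1 = 1" "a n = n"
      and fib: "\<And>x. x \<in> {1..n} \<Longrightarrow> a x = k \<longleftrightarrow> x = k"
      by (auto simp: end_fixing_maps_def)
    have "a x \<in> ?F x" if x: "x \<in> {1..n}" for x
    proof -
      have "a x \<in> {1..n}" "x \<le> k \<Longrightarrow> a x \<le> a k" "k \<le> x \<Longrightarrow> a k \<le> a x" "a k = k"
        using order_preserving_maps_D[OF a(1)] x k fib by auto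
      then show ?thesis
        using fib[OF x] a k by auto
    qed
    then show "a \<in> monotone_choices {1..n} ?F"
      using a by (auto simp: order_preserving_maps_def monotone_choices_def PiE_def)
  next
    fix a assume a: "a \<in> monotone_choices {1..n} ?F"
    have v: "a x \<in> ?F x" if "x \<in> {1..n}" for x
      using monotone_choices_value[OF a that] .
    have "a x \<in> {1..n} \<and> (a x = k \<longleftrightarrow> x = k)" if "x \<in> {1..n}" for x
      using v[OF that] that k by (auto split: if_splits)
    moreover have "n \<in> {1..n}" "1 < k" "k < n"
      using k by auto
    then have "a 1 = 1" "a n = n"
      using v[of 1] v[of n] by auto
    ultimately show "a \<in> {a \<in> end_fixing_maps n. \<forall>x \<in> {1..n}. a x = k \<longleftrightarrow> x = k}"
      using a by (auto simp: end_fixing_maps_def order_preserving_maps_def monotone_choices_def PiE_iff)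
  qed
  moreover have "{1..n} = insert 1 {2..k - 1} \<union> insert k (insert n {k + 1..n - 1})"
    using k by auto
  ultimately have "card {a \<in> end_fixing_maps n. \<forall>x \<in> {1..n}. a x = k \<longleftrightarrow> x = k}
      = card (monotone_choices (insert 1 {2..k - 1} \<union> insert k (insert n {k + 1..n - 1})) ?F)"
    by simp
  also have "\<dots> = card (monotone_choices (insert 1 {2..k - 1}) ?F)
      * card (monotone_choices (insert k (insert n {k + 1..n - 1})) ?F)"
    by (rule card_monotone_choices_Un) (use k in \<open>auto split: if_splits\<close>)
  also have "card (monotone_choices (insert 1 {2..k - 1}) ?F)
      = card (monotone_choices {2..k - 1} ?F)"
    by (rule card_monotone_choices_pin_first[where v = 1]) (use k in \<open>auto split: if_splits\<close>)
  also have "monotone_choices {2..k - 1} ?F = monotone_choices {2..k - 1} (\<lambda>_. {1..k - 1})"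
    by (rule monotone_choices_cong) (use k in auto)
  also have "card (monotone_choices (insert k (insert n {k + 1..n - 1})) ?F)
      = card (monotone_choices (insert n {k + 1..n - 1}) ?F)"
    by (rule card_monotone_choices_pin_first[where v = k]) (use k in \<open>auto split: if_splits\<close>)
  also have "\<dots> = card (monotone_choices {k + 1..n - 1} ?F)"
    by (rule card_monotone_choices_pin_last[where v = n]) (use k in \<open>auto split: if_splits\<close>)
  also have "monotone_choices {k + 1..n - 1} ?F
      = monotone_choices {k + 1..n - 1} (\<lambda>_. {k + 1..n})"
    by (rule monotone_choices_cong) (use k in auto)
  also have "card (monotone_choices {2..k - 1} (\<lambda>_. {1..k - 1})) = (2 * k - 4) choose (k - 2)"
  proof -
    have "k - 2 + (k - 1) - 1 = 2 * k - 4" using k by simp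
    then show ?thesis
      using k by (simp add: card_monotone_choices_const numeral_eq_Suc)
  qed
  also have "card (monotone_choices {k + 1..n - 1} (\<lambda>_. {k + 1..n}))
      = (2 * n - 2 * k - 2) choose (n - k - 1)"
  proof -
    have "n - k - 1 + (n - k) - 1 = 2 * n - 2 * k - 2" using k by simp
    then show ?thesis
      by (simp add: card_monotone_choices_const)
  qed
  finally show ?thesis .
qed

lemma card_Z_set_interior:
  assumes k: "2 \<le> k" "k \<le> n - 1"
  shows "int (card (Z_set n k)) = int (card (R_set n k))
    - (int ((2 * n - 4) choose (n - 1))
       - int ((2 * k - 4) choose (k - 2)) * int ((2 * n - 2 * k - 2) choose (n - k - 1)))"
proof -
  define E where "E = end_fixing_maps n"
  define T where "T = {a \<in> end_fixing_maps n. a ` {1..n} \<subseteq> {1..n} - {k}}"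
  define U where "U = {a \<in> end_fixing_maps n. \<forall>x \<in> {1..n}. a x = k \<longleftrightarrow> x = k}"
  have n: "n \<ge> 3" and kn: "k \<in> {1..n}" "1 < k" "k < n"
    using k by auto
  have fin: "finite (order_preserving_maps n)"
    unfolding order_preserving_maps_eq by (rule finite_monotone_choices) auto
  then have finE: "finite E"
    by (simp add: E_def end_fixing_maps_def)
  have finR: "finite (R_set n k)"
    using fin by (simp add: R_set_def)
  \<comment> \<open>\<open>T\<close> and \<open>U\<close> collect the two ways in which a map can fail to send a point other than \<open>k\<close> to \<open>k\<close>.\<close>
  have diff: "R_set n k - Z_set n k = E - (T \<union> U)"
  proof (intro equalityI subsetI)
    fix a assume "a \<in> R_set n k - Z_set n k"
    then show "a \<in> E - (T \<union> U)"
      using kn by (auto simp: Z_set_def R_set_iff L_set_iff E_def T_def U_def end_fixing_maps_def)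
  next
    fix a assume a: "a \<in> E - (T \<union> U)"
    then have fixed: "a \<in> order_preserving_maps n" "a 1 = 1" "a n = n"
      by (auto simp: E_def end_fixing_maps_def)
    have "\<not> a ` {1..n} \<subseteq> {1..n} - {k}"
      using a by (auto simp: E_def T_def)
    then obtain x where x: "x \<in> {1..n}" "a x = k"
      using order_preserving_maps_D(1)[OF fixed(1)] by blast
    have "\<not> (\<forall>y \<in> {1..n}. a y = k \<longleftrightarrow> y = k)"
      using a unfolding E_def U_def by blast
    then obtain y where y: "y \<in> {1..n}" "(a y = k) \<noteq> (y = k)"
      by blast
    have "\<exists>z \<in> {1..n}. z \<noteq> k \<and> a z = k"
    proof (cases "x = k")
      case True
      with x y have "y \<noteq> k \<and> a y = k" by metis
      with y show ?thesis by blast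
    next
      case False
      with x show ?thesis by blast
    qed
    then show "a \<in> R_set n k - Z_set n k"
      unfolding Diff_iff Z_set_def Int_iff R_set_iff[OF kn(1)] L_set_iff[OF kn(1)]
      using fixed by simp
  qed
  have "T \<inter> U = {}"
    using kn(1) unfolding T_def U_def by blast
  moreover have sub: "T \<subseteq> E" "U \<subseteq> E"
    by (auto simp: T_def U_def E_def)
  ultimately have cTU: "card (T \<union> U) = card T + card U"
    using finE by (meson card_Un_disjoint finite_subset)
  have "E = {a \<in> end_fixing_maps n. a ` {1..n} \<subseteq> {1..n}}"
    using order_preserving_maps_D(1) by (auto simp: E_def end_fixing_maps_def)
  then have cE: "card E = (n - 2 + n - 1) choose (n - 2)"
    using card_end_fixing_maps_into[of n "{1..n}"] n by simp
  have cT: "card T = (n - 2 + (n - 1) - 1) choose (n - 2)"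
    unfolding T_def using card_end_fixing_maps_into[of n "{1..n} - {k}"] n kn by simp
  have pascal: "card E = ((2 * n - 4) choose (n - 1)) + card T"
  proof -
    obtain m where m: "n = m + 3"
      using n by (metis add.commute le_Suc_ex)
    \<comment> \<open>Pascal's rule gives the lower index \<open>n - 3\<close>; symmetry turns it into \<open>n - 1\<close>.\<close>
    have "(2 * m + 2) choose m = (2 * m + 2) choose (m + 2)"
      using binomial_symmetric[of m "2 * m + 2"] by simp
    then show ?thesis
      unfolding cE cT m by (simp add: numeral_eq_Suc mult_2)
  qed
  have "card (R_set n k) = card (Z_set n k) + card (R_set n k - Z_set n k)"
    using finR card_mono[of "R_set n k" "Z_set n k"]
    by (subst card_Diff_subset) (auto simp: Z_set_def finite_subset)
  moreover have "card E = card (T \<union> U) + card (E - (T \<union> U))"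
    using finE sub card_mono[of E "T \<union> U"]
    by (subst card_Diff_subset) (auto intro: finite_subset)
  moreover have "card U = ((2 * k - 4) choose (k - 2)) * ((2 * n - 2 * k - 2) choose (n - k - 1))"
    unfolding U_def using card_end_fixing_maps_singleton_fibre[OF k] .
  ultimately show ?thesis
    using diff cTU pascal by simp
qed

theorem lemma3:
  fixes n :: nat
  assumes "n \<ge> 3"
  shows "card (Z_set n 1) = (2 * n - 4) choose (n - 2)
    \<and> card (Z_set n n) = (2 * n - 4) choose (n - 2)
    \<and> (\<forall>k. 2 \<le> k \<and> k \<le> n - 1 \<longrightarrow>
          int (card (Z_set n k)) = int (card (R_set n k))
            - (int ((2 * n - 4) choose (n - 1))
               - int ((2 * k - 4) choose (k - 2)) * int ((2 * n - 2 * k - 2) choose (n - k - 1))))"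
  using card_Z_set_first[OF assms] card_Z_set_last[OF assms] card_Z_set_interior by blast

end
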